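(* Let $G=(V,E)$ be a finite directed graph with GNN computation graph $\mathcal{G}=(L,R,\mathcal{E})$, and let $d,k\ge 1$ be integers. For a $d$-HAG computation graph $\hat{\mathcal G}$ with $k$ internal nodes, define $$\widetilde{\mathrm{value}}(\hat{\mathcal G}) := \mathrm{value}(\hat{\mathcal G}) + k(d-1).$$ Let $\hat{\mathcal G}_{greedy}$ be the single-layer $d$-HAG computation graph (with $k$ internal nodes) returned by the single-layer version of the algorithm FullGreedy on input $\mathcal G$, $k$, $d$ (with any tie-breaking), and let $\hat{\mathcal G}^*$ be a single-layer $d$-HAG computation graph for $G$ with $k$ internal nodes having the largest value (and hence also the largest $\widetilde{\mathrm{value}}$) among all such graphs. Then $$\widetilde{\mathrm{value}}(\hat{\mathcal G}_{greedy}) \ \ge\ \frac1d\left(1-\frac1e\right)\widetilde{\mathrm{value}}(\hat{\mathcal G}^* ).$$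
   Context: GNN computation graph. For a directed graph $G=(V,E)$, $\mathcal G=(L,R,\mathcal E)$ is the bipartite directed graph where $L=\{v_L\}$ and $R=\{v_R\}$ are two disjoint copies of $V$ and $(u_L,v_R)\in\mathcal E$ iff $(u,v)\in E$. $\Gamma_{in},\Gamma_{out}$ denote in- and out-neighborhoods in $\mathcal G$. Single-layer $d$-HAG computation graph for $G$ (equivalently, equivalent to $\mathcal G$): a directed graph $\hat{\mathcal G}=(L\cup M\cup R,\hat{\mathcal E})$, $M$ a finite set of internal (intermediate) nodes, with edges only from $L$ to $M$, from $M$ to $R$, and directly from $L$ to $R$, such that every $m\in M$ has exactly $d$ in-neighbors (all in $L$), and for $u,v\in V$ there is exactly one directed path from $u_L$ to $v_R$ if $(u,v)\in E$, and none if $(u,v)\notin E$. $\hat\Gamma_{in},\hat\Gamma_{out}$ denote in- and out-neighborhoods in $\hat{\mathcal G}$. Value. For a single-layer $d$-HAG computation graph, $\mathrm{value}(\hat{\mathcal G})=\sum_{m\in M}(|\hat\Gamma_{out}(m)|-1)(|\hat\Gamma_{in}(m)|-1)=(d-1)\sum_{m\in M}(|\hat\Gamma_{out}(m)|-1)$. FullGreedy (single-layer version), input $\mathcal G,k,d$ (with $d\le |L|$). Start with $\hat{\mathcal G}_0=\mathcal G$ and $M_0=\emptyset$. For $i=1,\dots,k$: choose $C\subseteq L$ with $|C|=d$ maximizing $|R_C|$, where $R_C=R\cap\bigcap_{v\in C}\hat\Gamma_{out}(v)$ with out-neighborhoods taken in the current graph $\hat{\mathcal G}_{i-1}$; add a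 new internal node $v_i$, add the edges $(\ell,v_i)$ for all $\ell\in C$ and $(v_i,r)$ for all $r\in R_C$, and remove all edges $(\ell,r)$ with $\ell\in C$, $r\in R_C$; the result is $\hat{\mathcal G}_i$. Return $\hat{\mathcal G}_k$. *)

theory Defs
  imports Complex_Main "Graph_Theory.Pair_Digraph"
begin

text \<open>
  \<open>LNode v\<close> and \<open>RNode v\<close> are the copies $v_L$ and $v_R$ of a vertex \<open>v\<close>; \<open>MNode i\<close> is an
  internal node. A computation graph has finitely many internal nodes, so naming them by natural
  numbers loses no generality up to isomorphism.
\<close>

datatype 'v node = LNode 'v | MNode nat | RNode 'v

definition left_nodes :: "'v pair_pre_digraph \<Rightarrow> 'v node set" where
  "left_nodes G = LNode ` pverts G"

definition right_nodes :: "'v pair_pre_digraph \<Rightarrow> 'v node set" where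
  "right_nodes G = RNode ` pverts G"

definition internal_nodes :: "'v node pair_pre_digraph \<Rightarrow> 'v node set" where
  "internal_nodes H = pverts H \<inter> range MNode"

definition in_nbrs :: "'a pair_pre_digraph \<Rightarrow> 'a \<Rightarrow> 'a set" where
  "in_nbrs H x = {y. (y, x) \<in> parcs H}"

definition out_nbrs :: "'a pair_pre_digraph \<Rightarrow> 'a \<Rightarrow> 'a set" where
  "out_nbrs H x = {y. (x, y) \<in> parcs H}"

definition gnn_graph :: "'v pair_pre_digraph \<Rightarrow> 'v node pair_pre_digraph" where
  "gnn_graph G =
     \<lparr> pverts = left_nodes G \<union> right_nodes G,
       parcs = {(LNode u, RNode v) | u v. (u, v) \<in> parcs G} \<rparr>"

definition single_layer_hag ::
    "nat \<Rightarrow> 'v pair_pre_digraph \<Rightarrow> 'v node pair_pre_digraph \<Rightarrow> bool" where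
  "single_layer_hag d G H \<longleftrightarrow>
     finite (internal_nodes H) \<and>
     pverts H = left_nodes G \<union> internal_nodes H \<union> right_nodes G \<and>
     parcs H \<subseteq> left_nodes G \<times> internal_nodes H \<union> internal_nodes H \<times> right_nodes G
                \<union> left_nodes G \<times> right_nodes G \<and>
     (\<forall>m\<in>internal_nodes H. card (in_nbrs H m) = d) \<and>
     (\<forall>u\<in>pverts G. \<forall>v\<in>pverts G.
        ((u, v) \<in> parcs G \<longrightarrow>
           (\<exists>!p. pre_digraph.apath (with_proj H) (LNode u) p (RNode v))) \<and>
        ((u, v) \<notin> parcs G \<longrightarrow>
           (\<nexists>p. pre_digraph.apath (with_proj H) (LNode u) p (RNode v))))"

text \<open>
  The value is real-valued because an internal node without out-neighbors contributes negatively.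
\<close>

definition hag_value :: "'v node pair_pre_digraph \<Rightarrow> real" where
  "hag_value H =
     (\<Sum>m\<in>internal_nodes H.
        (real (card (out_nbrs H m)) - 1) * (real (card (in_nbrs H m)) - 1))"

definition hag_value_tilde :: "nat \<Rightarrow> 'v node pair_pre_digraph \<Rightarrow> real" where
  "hag_value_tilde d H = hag_value H + real (card (internal_nodes H)) * (real d - 1)"

definition common_right ::
    "'v pair_pre_digraph \<Rightarrow> 'v node pair_pre_digraph \<Rightarrow> 'v node set \<Rightarrow> 'v node set" where
  "common_right G H C = right_nodes G \<inter> (\<Inter>v\<in>C. out_nbrs H v)"

definition greedy_step ::
    "'v pair_pre_digraph \<Rightarrow> 'v node \<Rightarrow> 'v node set \<Rightarrow> 'v node pair_pre_digraph
       \<Rightarrow> 'v node pair_pre_digraph" where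
  "greedy_step G m C H =
     \<lparr> pverts = insert m (pverts H),
       parcs = (parcs H - C \<times> common_right G H C) \<union> C \<times> {m} \<union> {m} \<times> common_right G H C \<rparr>"

text \<open>
  \<open>full_greedy d G k H\<close> says that \<open>H\<close> can be returned by \<open>k\<close> rounds of the algorithm for some way
  of breaking ties. For \<open>k > 0\<close> it forces \<open>d \<le> card (pverts G)\<close>, since otherwise no
  \<open>C\<close> can be chosen.
\<close>

inductive full_greedy ::
    "nat \<Rightarrow> 'v pair_pre_digraph \<Rightarrow> nat \<Rightarrow> 'v node pair_pre_digraph \<Rightarrow> bool"
  for d :: nat and G :: "'v pair_pre_digraph" where
  init: "full_greedy d G 0 (gnn_graph G)"
| round: "full_greedy d G i H \<Longrightarrow>
     is_arg_max (\<lambda>C. card (common_right G H C)) (\<lambda>C. C \<subseteq> left_nodes G \<and> card C = d) C \<Longrightarrow>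
     full_greedy d G (Suc i) (greedy_step G (MNode (Suc i)) C H)"

end

theory Submission
  imports Defs
begin

text \<open>
  If every internal node \<open>m\<close> has \<open>d\<close> in-neighbors, then \<open>hag_value_tilde\<close> is \<open>d - 1\<close> times the
  total out-degree of the internal nodes. In a computation graph for \<open>G\<close> the rectangles
  \<open>in_nbrs H m \<times> out_nbrs H m\<close> are pairwise disjoint sets of edges of \<open>gnn_graph G\<close>, because paths
  are unique. Once the greedy algorithm has reached total out-degree \<open>S\<close>, it has removed \<open>d * S\<close>
  edges, and each of them spoils at most one pair \<open>(m, r)\<close> of an optimal solution. If the optimal
  total out-degree is \<open>W\<close>, some internal node of the optimal solution thus still has at least
  \<open>(W - d * S) / k\<close> usable out-neighbors, and the greedy choice is at least as good. Hence
  \<open>W - d * S\<close> shrinks by a factor \<open>1 - 1 / k\<close> in each round as long as it is positive.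
\<close>

section \<open>Total out-degree and a counting bound for disjoint rectangles\<close>

definition total_out :: "'v node pair_pre_digraph \<Rightarrow> nat" where
  "total_out H = (\<Sum>m\<in>internal_nodes H. card (out_nbrs H m))"

text \<open>The added term \<open>card (internal_nodes H) * (real d - 1)\<close> cancels the
  \<open>- 1\<close> next to each out-degree, so what remains grows in each round by exactly the
  size of the chosen common neighborhood.\<close>

lemma hag_value_tilde_eq:
  assumes "\<forall>m\<in>internal_nodes H. card (in_nbrs H m) = d"
  shows "hag_value_tilde d H = (real d - 1) * real (total_out H)"
proof -
  have "hag_value H = (\<Sum>m\<in>internal_nodes H. (real (card (out_nbrs H m)) - 1) * (real d - 1))"
    using assms by (simp add: hag_value_def)
  also have "\<dots> = (real (total_out H) - real (card (internal_nodes H))) * (real d - 1)"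
    by (simp add: total_out_def sum_subtractf flip: sum_distrib_right)
  finally show ?thesis
    by (simp add: hag_value_tilde_def algebra_simps)
qed

text \<open>Each \<open>r\<close> in \<open>B m\<close> that violates the condition is the second
  component of some pair in \<open>D \<inter> (A m \<times> B m)\<close>, and by disjointness a pair
  of \<open>D\<close> is charged to at most one \<open>m\<close>. In the application,
  \<open>D\<close> consists of the arcs removed by the greedy algorithm.\<close>

lemma sum_card_le_of_disjoint_rectangles:
  assumes "finite I" "finite D"
    and fin: "\<And>m. m \<in> I \<Longrightarrow> finite (B m)"
    and disj: "\<And>m n. m \<in> I \<Longrightarrow> n \<in> I \<Longrightarrow> m \<noteq> n \<Longrightarrow> (A m \<times> B m) \<inter> (A n \<times> B n) = {}"
  shows "(\<Sum>m\<in>I. card (B m)) \<le> (\<Sum>m\<in>I. card {r \<in> B m. \<forall>l\<in>A m. (l, r) \<notin> D}) + card D"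
proof -
  define DD where "DD m = D \<inter> (A m \<times> B m)" for m
  have "card (B m) \<le> card {r \<in> B m. \<forall>l\<in>A m. (l, r) \<notin> D} + card (DD m)" if "m \<in> I" for m
  proof -
    have "B m \<subseteq> {r \<in> B m. \<forall>l\<in>A m. (l, r) \<notin> D} \<union> snd ` DD m"
      by (force simp: DD_def image_iff)
    then have "card (B m) \<le> card ({r \<in> B m. \<forall>l\<in>A m. (l, r) \<notin> D} \<union> snd ` DD m)"
      using \<open>finite D\<close> fin[OF that] by (intro card_mono) (auto simp: DD_def)
    also have "\<dots> \<le> card {r \<in> B m. \<forall>l\<in>A m. (l, r) \<notin> D} + card (snd ` DD m)"
      by (rule card_Un_le)
    finally show ?thesis
      using card_image_le[of "DD m" snd] \<open>finite D\<close> by (simp add: DD_def)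
  qed
  then have "(\<Sum>m\<in>I. card (B m))
      \<le> (\<Sum>m\<in>I. card {r \<in> B m. \<forall>l\<in>A m. (l, r) \<notin> D}) + (\<Sum>m\<in>I. card (DD m))"
    by (simp add: sum_mono flip: sum.distrib)
  moreover have "(\<Sum>m\<in>I. card (DD m)) = card (\<Union>m\<in>I. DD m)"
  proof (rule card_UN_disjoint[symmetric])
    show "\<forall>m\<in>I. \<forall>n\<in>I. m \<noteq> n \<longrightarrow> DD m \<inter> DD n = {}"
      using disj unfolding DD_def by blast
  qed (use assms(1,2) in \<open>simp_all add: DD_def\<close>)
  moreover have "\<dots> \<le> card D"
    using \<open>finite D\<close> by (intro card_mono) (auto simp: DD_def)
  ultimately show ?thesis by linarith
qed

section \<open>Rectangles of internal nodes and paths of length two\<close>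

lemma apath_two:
  assumes "a \<in> pverts H" "(a, b) \<in> parcs H" "(b, c) \<in> parcs H" "a \<noteq> b" "b \<noteq> c" "a \<noteq> c"
  shows "pre_digraph.apath (with_proj H) a [(a, b), (b, c)] c"
  using assms
  by (simp add: pre_digraph.apath_def pre_digraph.awalk_def pre_digraph.cas.simps
      pre_digraph.awalk_verts.simps)

lemma internal_nodes_iff: "m \<in> internal_nodes H \<longleftrightarrow> m \<in> pverts H \<and> (\<exists>i. m = MNode i)"
  by (auto simp: internal_nodes_def)

lemma hag_parcs:
  assumes "single_layer_hag d G H" "(x, y) \<in> parcs H"
  shows "x \<in> left_nodes G \<and> y \<in> internal_nodes H \<or> x \<in> internal_nodes H \<and> y \<in> right_nodes G
    \<or> x \<in> left_nodes G \<and> y \<in> right_nodes G"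
  using assms unfolding single_layer_hag_def by blast

lemma hag_in_nbrs_subset:
  assumes "single_layer_hag d G H" "m \<in> internal_nodes H"
  shows "in_nbrs H m \<subseteq> left_nodes G"
  using hag_parcs[OF assms(1)] assms(2)
  by (fastforce simp: in_nbrs_def internal_nodes_iff right_nodes_def)

lemma hag_out_nbrs_subset:
  assumes "single_layer_hag d G H" "m \<in> internal_nodes H"
  shows "out_nbrs H m \<subseteq> right_nodes G"
  using hag_parcs[OF assms(1)] assms(2)
  by (fastforce simp: out_nbrs_def internal_nodes_iff left_nodes_def)

text \<open>Turns a pair of a rectangle into a path through \<open>m\<close>. The two path
  conditions of \<open>single_layer_hag\<close> then yield, respectively, that the rectangle
  consists of original arcs and that rectangles do not overlap.\<close>

lemma hag_apath:
  assumes hag: "single_layer_hag d G H" and m: "m \<in> internal_nodes H"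
    and "l \<in> in_nbrs H m" "r \<in> out_nbrs H m"
  obtains u v where "u \<in> pverts G" "v \<in> pverts G" "l = LNode u" "r = RNode v"
    "pre_digraph.apath (with_proj H) (LNode u) [(l, m), (m, r)] (RNode v)"
proof -
  obtain u v where uv: "u \<in> pverts G" "v \<in> pverts G" "l = LNode u" "r = RNode v"
    using subsetD[OF hag_in_nbrs_subset[OF hag m] assms(3)]
      subsetD[OF hag_out_nbrs_subset[OF hag m] assms(4)]
    by (auto simp: left_nodes_def right_nodes_def)
  moreover have "LNode u \<in> pverts H"
    using hag uv by (auto simp: single_layer_hag_def left_nodes_def)
  ultimately have "pre_digraph.apath (with_proj H) (LNode u) [(l, m), (m, r)] (RNode v)"
    using assms(3,4) m by (auto intro!: apath_two simp: in_nbrs_def out_nbrs_def internal_nodes_iff)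
  with uv show thesis by (rule that)
qed

lemma hag_rectangle_subset:
  assumes hag: "single_layer_hag d G H" and m: "m \<in> internal_nodes H"
  shows "in_nbrs H m \<times> out_nbrs H m \<subseteq> parcs (gnn_graph G)"
proof clarify
  fix l r assume lr: "l \<in> in_nbrs H m" "r \<in> out_nbrs H m"
  obtain u v where uv: "u \<in> pverts G" "v \<in> pverts G" "l = LNode u" "r = RNode v"
    "pre_digraph.apath (with_proj H) (LNode u) [(l, m), (m, r)] (RNode v)"
    using hag_apath[OF hag m lr] .
  with hag have "(u, v) \<in> parcs G"
    unfolding single_layer_hag_def by blast
  with uv show "(l, r) \<in> parcs (gnn_graph G)" by (simp add: gnn_graph_def)
qed

text \<open>A common pair would be joined by two different paths, one through \<open>m\<close> and
  one through \<open>n\<close>.\<close>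

lemma hag_rectangles_disjoint:
  assumes hag: "single_layer_hag d G H"
    and m: "m \<in> internal_nodes H" and n: "n \<in> internal_nodes H" and "m \<noteq> n"
  shows "(in_nbrs H m \<times> out_nbrs H m) \<inter> (in_nbrs H n \<times> out_nbrs H n) = {}"
proof (rule ccontr)
  assume "\<not> ?thesis"
  then obtain l r where lr: "l \<in> in_nbrs H m" "r \<in> out_nbrs H m" "l \<in> in_nbrs H n" "r \<in> out_nbrs H n"
    by blast
  obtain u v where uv: "u \<in> pverts G" "v \<in> pverts G" "l = LNode u" "r = RNode v"
    and p: "pre_digraph.apath (with_proj H) (LNode u) [(l, m), (m, r)] (RNode v)"
    using hag_apath[OF hag m lr(1,2)] .
  have q: "pre_digraph.apath (with_proj H) (LNode u) [(l, n), (n, r)] (RNode v)"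
    using hag_apath[OF hag n lr(3,4)] uv by auto
  \<comment> \<open>The path \<open>p\<close> itself rules out
    \<open>(u, v) \<notin> parcs G\<close>, so the uniqueness clause applies.\<close>
  have "\<exists>!p. pre_digraph.apath (with_proj H) (LNode u) p (RNode v)"
    using hag uv p unfolding single_layer_hag_def by blast
  with p q have "[(l, m), (m, r)] = [(l, n), (n, r)]" by blast
  with \<open>m \<noteq> n\<close> show False by simp
qed

section \<open>The greedy run and its progress against a fixed computation graph\<close>

lemma internal_nodes_greedy_step:
  "internal_nodes (greedy_step G (MNode i) C H) = insert (MNode i) (internal_nodes H)"
  by (auto simp: internal_nodes_def greedy_step_def)

text \<open>With \<open>C\<close> among the left nodes, neither the deleted arcs nor the arcs
  \<open>C \<times> {m}\<close> start at an internal node.\<close>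

lemma out_nbrs_greedy_step_old:
  "C \<subseteq> left_nodes G \<Longrightarrow> i \<noteq> j \<Longrightarrow> out_nbrs (greedy_step G (MNode i) C H) (MNode j) = out_nbrs H (MNode j)"
  by (auto simp: out_nbrs_def greedy_step_def left_nodes_def)

lemma in_nbrs_greedy_step_old:
  "i \<noteq> j \<Longrightarrow> in_nbrs (greedy_step G (MNode i) C H) (MNode j) = in_nbrs H (MNode j)"
  by (auto simp: in_nbrs_def greedy_step_def common_right_def right_nodes_def)

lemma full_greedy_internal_nodes:
  "full_greedy d G i H \<Longrightarrow> internal_nodes H = MNode ` {1..i}"
proof (induction rule: full_greedy.induct)
  case init
  show ?case by (auto simp: internal_nodes_def gnn_graph_def left_nodes_def right_nodes_def)
next
  case (round i H C)
  then show ?case by (simp add: internal_nodes_greedy_step atLeastAtMostSuc_conv)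
qed

text \<open>A round only adds arcs at its new node, so stale arcs there would survive; freshness
  makes the neighborhoods of the new node exactly \<open>C\<close> and
  \<open>common_right G H C\<close>.\<close>

lemma full_greedy_fresh:
  assumes "full_greedy d G i H" "i < j"
  shows "in_nbrs H (MNode j) = {} \<and> out_nbrs H (MNode j) = {}"
  using assms
proof (induction arbitrary: j rule: full_greedy.induct)
  case init
  show ?case by (simp add: in_nbrs_def out_nbrs_def gnn_graph_def)
next
  case (round i H C)
  from round.hyps(2) have "C \<subseteq> left_nodes G" by (simp add: is_arg_max_def)
  with round show ?case by (simp add: in_nbrs_greedy_step_old out_nbrs_greedy_step_old)
qed

lemma greedy_step_new:
  assumes "full_greedy d G i H" "C \<subseteq> left_nodes G"
  shows "in_nbrs (greedy_step G (MNode (Suc i)) C H) (MNode (Suc i)) = C"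
    and "out_nbrs (greedy_step G (MNode (Suc i)) C H) (MNode (Suc i)) = common_right G H C"
  using full_greedy_fresh[OF assms(1), of "Suc i"] assms(2)
  by (auto simp: in_nbrs_def out_nbrs_def greedy_step_def common_right_def right_nodes_def
      left_nodes_def)

lemma full_greedy_card_in_nbrs:
  "full_greedy d G i H \<Longrightarrow> \<forall>m\<in>internal_nodes H. card (in_nbrs H m) = d"
proof (induction rule: full_greedy.induct)
  case init
  show ?case by (auto simp: internal_nodes_def gnn_graph_def left_nodes_def right_nodes_def)
next
  case (round i H C)
  from round.hyps(2) have C: "C \<subseteq> left_nodes G" "card C = d" by (simp_all add: is_arg_max_def)
  show ?case
    using round.IH C greedy_step_new[OF round.hyps(1) C(1)]
    by (auto simp: internal_nodes_greedy_step full_greedy_internal_nodes[OF round.hyps(1)]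
        in_nbrs_greedy_step_old)
qed

lemma total_out_greedy_step:
  assumes "full_greedy d G i H" "C \<subseteq> left_nodes G"
  shows "total_out (greedy_step G (MNode (Suc i)) C H) = total_out H + card (common_right G H C)"
proof -
  note int = full_greedy_internal_nodes[OF assms(1)]
  have "finite (internal_nodes H)" "MNode (Suc i) \<notin> internal_nodes H"
    by (auto simp: int)
  moreover have "(\<Sum>m\<in>internal_nodes H. card (out_nbrs (greedy_step G (MNode (Suc i)) C H) m))
      = total_out H"
    unfolding total_out_def
    using assms(2) by (intro sum.cong) (auto simp: int out_nbrs_greedy_step_old)
  ultimately show ?thesis
    by (simp add: total_out_def[of "greedy_step _ _ _ _"] internal_nodes_greedy_step
        greedy_step_new[OF assms])
qed

text \<open>A round can newly lose only arcs of \<open>C \<times> common_right G H C\<close>, which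
  number at most \<open>d\<close> times the increase of \<open>total_out\<close>.\<close>

lemma full_greedy_card_removed:
  assumes "full_greedy d G i H" and fin: "finite (pverts G)" "finite (parcs (gnn_graph G))"
  shows "card (parcs (gnn_graph G) - parcs H) \<le> d * total_out H"
  using assms(1)
proof (induction rule: full_greedy.induct)
  case init
  show ?case by simp
next
  case (round i H C)
  let ?H' = "greedy_step G (MNode (Suc i)) C H"
  from round.hyps(2) have C: "C \<subseteq> left_nodes G" "card C = d" by (simp_all add: is_arg_max_def)
  have "finite C" "finite (common_right G H C)"
    using fin(1) C(1) by (auto simp: left_nodes_def right_nodes_def common_right_def
        intro: finite_subset)
  then have "card (parcs (gnn_graph G) - parcs ?H')
      \<le> card ((parcs (gnn_graph G) - parcs H) \<union> C \<times> common_right G H C)"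
    using fin(2) by (intro card_mono) (auto simp: greedy_step_def)
  also have "\<dots> \<le> card (parcs (gnn_graph G) - parcs H) + card (C \<times> common_right G H C)"
    by (rule card_Un_le)
  also have "\<dots> \<le> d * total_out H + d * card (common_right G H C)"
    using round.IH C(2) by (simp add: card_cartesian_product)
  finally show ?case
    by (simp add: total_out_greedy_step[OF round.hyps(1) C(1)] distrib_left)
qed

text \<open>The in-neighborhood of each internal node of \<open>K\<close> competes with
  \<open>C\<close>. Its usable out-neighbors therefore number at most
  \<open>card (common_right G H C)\<close>, and the others are paid for by removed arcs.\<close>

lemma greedy_choice_bound:
  assumes fin: "finite (pverts G)" "finite (parcs (gnn_graph G))"
    and greedy: "full_greedy d G i H"
    and arg_max: "is_arg_max (\<lambda>C. card (common_right G H C))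
      (\<lambda>C. C \<subseteq> left_nodes G \<and> card C = d) C"
    and hag: "single_layer_hag d G K"
  shows "total_out K \<le> card (internal_nodes K) * card (common_right G H C) + d * total_out H"
proof -
  let ?D = "parcs (gnn_graph G) - parcs H"
  let ?left = "\<lambda>m. {r \<in> out_nbrs K m. \<forall>l\<in>in_nbrs K m. (l, r) \<notin> ?D}"
  have finR: "finite (right_nodes G)" using fin(1) by (simp add: right_nodes_def)
  have "card (?left m) \<le> card (common_right G H C)" if m: "m \<in> internal_nodes K" for m
  proof -
    \<comment> \<open>The rectangle of \<open>m\<close> consists of original arcs, so an arc of it
      outside \<open>?D\<close> is still present in \<open>H\<close>.\<close>
    have "?left m \<subseteq> common_right G H (in_nbrs K m)"
      using hag_out_nbrs_subset[OF hag m] hag_rectangle_subset[OF hag m]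
      by (auto simp: common_right_def out_nbrs_def)
    then have "card (?left m) \<le> card (common_right G H (in_nbrs K m))"
      using finR by (intro card_mono) (auto simp: common_right_def)
    also have "\<dots> \<le> card (common_right G H C)"
      using arg_max hag_in_nbrs_subset[OF hag m] hag m
      by (auto simp: is_arg_max_def single_layer_hag_def not_less)
    finally show ?thesis .
  qed
  then have "(\<Sum>m\<in>internal_nodes K. card (?left m))
      \<le> card (internal_nodes K) * card (common_right G H C)"
    using sum_bounded_above[of "internal_nodes K" "\<lambda>m. card (?left m)"] by simp
  moreover have "total_out K \<le> (\<Sum>m\<in>internal_nodes K. card (?left m)) + card ?D"
    unfolding total_out_def
  proof (rule sum_card_le_of_disjoint_rectangles)
    show "finite (internal_nodes K)" using hag by (simp add: single_layer_hag_def)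
    show "finite ?D" using fin(2) by simp
    show "finite (out_nbrs K m)" if "m \<in> internal_nodes K" for m
      using hag_out_nbrs_subset[OF hag that] finR by (rule finite_subset)
  qed (rule hag_rectangles_disjoint[OF hag])
  ultimately show ?thesis
    using full_greedy_card_removed[OF greedy fin] by linarith
qed

text \<open>Induction on the rounds: the deficit \<open>total_out K - d * total_out H\<close>, taken
  in the reals, is compared with a geometric sequence. Its sign is irrelevant, since the induction
  hypothesis is only multiplied by the nonnegative factor \<open>1 - 1 / k\<close>.\<close>

lemma full_greedy_total_out:
  assumes fin: "finite (pverts G)" "finite (parcs (gnn_graph G))" and "d \<ge> 1"
    and hag: "single_layer_hag d G K" "card (internal_nodes K) = k" "k \<ge> 1"
    and "full_greedy d G i H"
  shows "real (total_out K) - real d * real (total_out H) \<le> (1 - 1 / real k) ^ i * real (total_out K)"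
  using assms(7)
proof (induction rule: full_greedy.induct)
  case init
  show ?case by simp
next
  case (round i H C)
  let ?W = "real (total_out K)" and ?S = "real (total_out H)" and ?c = "real (card (common_right G H C))"
  from round.hyps(2) have C: "C \<subseteq> left_nodes G" by (simp add: is_arg_max_def)
  have k: "0 \<le> 1 - 1 / real k" using \<open>k \<ge> 1\<close> by simp
  have "?W \<le> real k * ?c + real d * ?S"
    using greedy_choice_bound[OF fin round.hyps hag(1)] hag(2)
    by (metis of_nat_add of_nat_le_iff of_nat_mult)
  then have "(?W - real d * ?S) / real k \<le> ?c"
    using \<open>k \<ge> 1\<close> by (simp add: divide_le_eq mult.commute)
  \<comment> \<open>A round lowers the deficit by \<open>d * ?c\<close>; a decrease of
    \<open>?c\<close> already gives the factor \<open>1 - 1 / k\<close>.\<close>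
  also have "?c \<le> real d * ?c" using \<open>d \<ge> 1\<close> by (simp add: mult_le_cancel_right1)
  finally have "?W - real d * (?S + ?c) \<le> (1 - 1 / real k) * (?W - real d * ?S)"
    by (simp add: algebra_simps diff_divide_distrib)
  also have "\<dots> \<le> (1 - 1 / real k) * ((1 - 1 / real k) ^ i * ?W)"
    using round.IH k by (rule mult_left_mono)
  finally show ?case
    by (simp add: total_out_greedy_step[OF round.hyps(1) C])
qed

section \<open>Exponential estimate and conclusion\<close>

lemma one_minus_inverse_power_le:
  assumes "k \<ge> 1"
  shows "(1 - 1 / real k) ^ k \<le> 1 / exp 1"
proof -
  \<comment> \<open>This is \<open>1 + x \<le> exp x\<close> at \<open>x = - 1 / k\<close>, raised
    to the power \<open>k\<close>; the base is nonnegative because \<open>k \<ge> 1\<close>.\<close>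
  have "(1 - 1 / real k) ^ k \<le> exp (- (1 / real k)) ^ k"
    using assms exp_ge_add_one_self[of "- (1 / real k)"] by (intro power_mono) auto
  also have "\<dots> = exp (- 1)"
    using assms by (simp flip: exp_of_nat_mult)
  finally show ?thesis by (simp add: exp_minus inverse_eq_divide)
qed

theorem theorem13:
  fixes G :: "'v pair_pre_digraph" and d k :: nat
    and H_greedy H_opt :: "'v node pair_pre_digraph"
  assumes "pair_fin_digraph G"
    and "d \<ge> 1" and "k \<ge> 1"
    and "full_greedy d G k H_greedy"
    and "is_arg_max hag_value
           (\<lambda>H. single_layer_hag d G H \<and> card (internal_nodes H) = k) H_opt"
  shows "hag_value_tilde d H_greedy \<ge> 1 / real d * (1 - 1 / exp 1) * hag_value_tilde d H_opt"
proof -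
  interpret pair_fin_digraph G by fact
  have hag: "single_layer_hag d G H_opt" "card (internal_nodes H_opt) = k"
    using assms(5) by (simp_all add: is_arg_max_def)
  have "parcs (gnn_graph G) = (\<lambda>(u, v). (LNode u, RNode v)) ` parcs G"
    by (auto simp: gnn_graph_def)
  then have fin: "finite (pverts G)" "finite (parcs (gnn_graph G))"
    by simp_all
  let ?W = "real (total_out H_opt)" and ?S = "real (total_out H_greedy)"
  have "?W - real d * ?S \<le> (1 - 1 / real k) ^ k * ?W"
    using full_greedy_total_out[OF fin assms(2) hag assms(3,4)] .
  also have "\<dots> \<le> 1 / exp 1 * ?W"
    using one_minus_inverse_power_le[OF assms(3)] by (rule mult_right_mono) simp
  finally have "(1 - 1 / exp 1) * ?W \<le> real d * ?S"
    by (simp add: algebra_simps)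
  \<comment> \<open>The factor \<open>1 / d\<close> enters here: a unit of greedy out-degree may
    remove \<open>d\<close> arcs, hence spoil up to \<open>d\<close> units of
    \<open>?W\<close>.\<close>
  then have "1 / real d * (1 - 1 / exp 1) * ?W \<le> ?S"
    using assms(2) by (simp add: divide_le_eq mult.commute)
  \<comment> \<open>Scaling by \<open>d - 1\<close>, which is nonnegative, turns out-degrees into
    values; for \<open>d = 1\<close> both sides vanish.\<close>
  then have "(real d - 1) * (1 / real d * (1 - 1 / exp 1) * ?W) \<le> (real d - 1) * ?S"
    using assms(2) by (intro mult_left_mono) auto
  moreover have "hag_value_tilde d H_opt = (real d - 1) * ?W"
    using hag by (intro hag_value_tilde_eq) (simp add: single_layer_hag_def)
  moreover have "hag_value_tilde d H_greedy = (real d - 1) * ?S"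
    using full_greedy_card_in_nbrs[OF assms(4)] by (rule hag_value_tilde_eq)
  ultimately show ?thesis by (simp only: mult.left_commute)
qed

end
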